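(* Let $F_k$ and $L_k$ denote the $k$th Fibonacci and Lucas numbers, let $\varphi=\frac{1+\sqrt5}{2}$ be the golden ratio, and let $a$ and $b$ be positive integers. Then $$\prod_{n=1}^{\infty}\left(1+\frac{F_b}{F_{2^n a+b}}\right)=\frac{1-(-1)^{b}\varphi^{-2a-2b}}{1-\varphi^{-2a}}$$ and $$\prod_{n=1}^{\infty}\left(1+\frac{L_b}{L_{2^n a+b}}\right)=\frac{1+(-1)^{b}\varphi^{-2a-2b}}{1-\varphi^{-2a}}.$$ In particular, $$\prod_{n=1}^{\infty}\left(1+\frac{1}{F_{2^n+1}}\right)=\frac{3}{\varphi} \qquad\text{and}\qquad \prod_{n=1}^{\infty}\left(1+\frac{1}{L_{2^n+1}}\right)=3-\varphi.$$
   Context: For $k\ge 0$, the Fibonacci numbers $F_k$ are defined by $F_0=0$, $F_1=1$, $F_{k+2}=F_{k+1}+F_k$, and the Lucas numbers $L_k$ are defined by $L_0=2$, $L_1=1$, $L_{k+2}=L_{k+1}+L_k$. In the subscripts, $2^n a+b$ means $(2^n\cdot a)+b$ and $2^n+1$ means $(2^n)+1$. An infinite product $\prod_{n=1}^{\infty}u_n$ denotes the limit of the partial products $\prod_{n=1}^{N}u_n$ as $N\to\infty$. *)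

theory Defs
  imports "HOL-Analysis.Analysis" "HOL-Number_Theory.Fib"
begin

fun lucas :: "nat \<Rightarrow> nat" where
  "lucas 0 = 2"
| "lucas (Suc 0) = 1"
| "lucas (Suc (Suc n)) = lucas (Suc n) + lucas n"

definition golden_ratio :: real where
  "golden_ratio = (1 + sqrt 5) / 2"

end

theory Submission
  imports Defs
begin

text \<open>
  Both sequences have the form \<open>U k = A * (\<phi>^k - e * \<psi>^k)\<close> with \<open>\<psi> = -1/\<phi>\<close>, where \<open>e = 1\<close> for
  Fibonacci and \<open>e = -1\<close> for Lucas numbers. If \<open>m\<close> is even then \<open>\<psi>^m = 1/\<phi>^m\<close>, and with
  \<open>y = 1/\<phi>^m\<close> and \<open>c = e * (-1)^b / \<phi>^(2*b)\<close> one obtains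
  \<open>U b / U (m + b) = y * (1 - c) / (1 - c * y^2)\<close>, so that
  \<open>1 + U b / U (m + b) = (1 + y) * (1 - c * y) / (1 - c * y^2)\<close>.

  For \<open>m = 2^n * a\<close> the next value of \<open>y\<close> is the square of the current one. Since moreover
  \<open>1 + y = (1 - y^2) / (1 - y)\<close>, both parts of the factor telescope, and as the last \<open>y\<close> tends
  to \<open>0\<close> only the contribution \<open>(1 - c * y) / (1 - y)\<close> of the first value \<open>y = 1/\<phi>^(2*a)\<close>
  survives (\<open>telescoping_product_limit\<close>, \<open>binet_product_limit\<close>).
\<close>

text \<open>
  Writing \<open>z\<close> for \<open>y^(2^n)\<close>, the factor is \<open>g (z^2) / g z\<close> with \<open>g t = (1 - t) / (1 - c * t)\<close>. The bounds on
  \<open>y\<close> and \<open>c\<close> keep every denominator away from \<open>0\<close>.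
\<close>
lemma telescoping_product:
  fixes y c :: real
  assumes "\<bar>y\<bar> < 1" "\<bar>c\<bar> \<le> 1"
  shows "(\<Prod>n=1..N. (1 + y ^ 2 ^ n) * (1 - c * y ^ 2 ^ n) / (1 - c * (y ^ 2 ^ n)\<^sup>2))
       = (1 - c * y\<^sup>2) / (1 - y\<^sup>2) * ((1 - y ^ 2 ^ Suc N) / (1 - c * y ^ 2 ^ Suc N))"
proof -
  have small: "\<bar>y ^ 2 ^ k\<bar> < 1" for k :: nat
    unfolding power_abs using assms(1) by (subst power_less_one_iff) auto
  have ne1: "1 - y ^ 2 ^ k \<noteq> 0" for k :: nat
    using small[of k] by auto
  have ne2: "1 - c * y ^ 2 ^ k \<noteq> 0" for k :: nat
  proof -
    have "\<bar>c * y ^ 2 ^ k\<bar> \<le> 1 * \<bar>y ^ 2 ^ k\<bar>"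
      unfolding abs_mult using assms(2) by (intro mult_right_mono) auto
    then show ?thesis using small[of k] by auto
  qed
  have sq: "(y ^ 2 ^ k)\<^sup>2 = y ^ 2 ^ Suc k" for k :: nat
    by (simp add: power_mult [symmetric] mult.commute)
  show ?thesis
  proof (induction N)
    case 0
    show ?case using ne1[of 1] ne2[of 1] by simp
  next
    case (Suc N)
    define z where "z = y ^ 2 ^ Suc N"
    have z: "y ^ 2 ^ Suc (Suc N) = z\<^sup>2"
      unfolding z_def sq ..
    have nz: "1 - z \<noteq> 0" "1 - c * z \<noteq> 0" "1 - c * z\<^sup>2 \<noteq> 0"
      using ne1[of "Suc N"] ne2[of "Suc N"] ne2[of "Suc (Suc N)"] unfolding z z_def by auto
    have "(1 - z) / (1 - c * z) * ((1 + z) * (1 - c * z) / (1 - c * z\<^sup>2))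
        = (1 - z\<^sup>2) / (1 - c * z\<^sup>2)"
      using nz(2,3) by (simp add: divide_simps) (simp add: algebra_simps power2_eq_square)
    note telescope = this
    have "(\<Prod>n=1..Suc N. (1 + y ^ 2 ^ n) * (1 - c * y ^ 2 ^ n) / (1 - c * (y ^ 2 ^ n)\<^sup>2))
        = (\<Prod>n=1..N. (1 + y ^ 2 ^ n) * (1 - c * y ^ 2 ^ n) / (1 - c * (y ^ 2 ^ n)\<^sup>2))
            * ((1 + z) * (1 - c * z) / (1 - c * z\<^sup>2))"
      unfolding z_def by (subst prod.nat_ivl_Suc') (simp, rule mult.commute)
    also have "\<dots> = (1 - c * y\<^sup>2) / (1 - y\<^sup>2) * ((1 - z) / (1 - c * z))
            * ((1 + z) * (1 - c * z) / (1 - c * z\<^sup>2))"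
      unfolding Suc z_def ..
    also have "\<dots> = (1 - c * y\<^sup>2) / (1 - y\<^sup>2) * ((1 - z\<^sup>2) / (1 - c * z\<^sup>2))"
      unfolding mult.assoc telescope ..
    finally show ?case
      unfolding z .
  qed
qed

lemma telescoping_product_limit:
  fixes y c :: real
  assumes "\<bar>y\<bar> < 1" "\<bar>c\<bar> \<le> 1"
  shows "(\<lambda>N. \<Prod>n=1..N. (1 + y ^ 2 ^ n) * (1 - c * y ^ 2 ^ n) / (1 - c * (y ^ 2 ^ n)\<^sup>2))
           \<longlonglongrightarrow> (1 - c * y\<^sup>2) / (1 - y\<^sup>2)"
proof -
  have "strict_mono (\<lambda>N. 2 ^ Suc N :: nat)"
    by (intro strict_monoI power_strict_increasing) auto
  moreover have "(\<lambda>k. y ^ k) \<longlonglongrightarrow> 0"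
    using assms(1) by (intro LIMSEQ_power_zero) simp
  ultimately have "(\<lambda>N. y ^ 2 ^ Suc N) \<longlonglongrightarrow> 0"
    using LIMSEQ_subseq_LIMSEQ[of "\<lambda>k. y ^ k" 0 "\<lambda>N. 2 ^ Suc N"] by (simp add: o_def)
  then have "(\<lambda>N. (1 - c * y\<^sup>2) / (1 - y\<^sup>2) * ((1 - y ^ 2 ^ Suc N) / (1 - c * y ^ 2 ^ Suc N)))
      \<longlonglongrightarrow> (1 - c * y\<^sup>2) / (1 - y\<^sup>2) * ((1 - 0) / (1 - c * 0))"
    by (intro tendsto_intros) auto
  then show ?thesis
    unfolding telescoping_product[OF assms] by simp
qed

lemma golden_ratio_gt_1: "golden_ratio > 1"
  unfolding golden_ratio_def by (simp add: real_less_rsqrt)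

lemma golden_ratio_square: "golden_ratio\<^sup>2 = golden_ratio + 1"
  unfolding golden_ratio_def by (simp add: power2_eq_square field_simps)

lemma golden_ratio_conjugate: "(1 - sqrt 5) / 2 = - (1 / golden_ratio)"
proof -
  have "(1 - sqrt 5) / 2 * golden_ratio = -1"
    unfolding golden_ratio_def by (simp add: field_simps)
  then show ?thesis
    using golden_ratio_gt_1 by (simp add: field_simps)
qed

lemma fib_binet:
  "real (fib n) = 1 / sqrt 5 * (golden_ratio ^ n - 1 * (- (1 / golden_ratio)) ^ n)"
  using fib_closed_form[of n] unfolding golden_ratio_conjugate[symmetric] unfolding golden_ratio_def
  by simp

lemma lucas_binet:
  "real (lucas n) = 1 * (golden_ratio ^ n - (-1) * (- (1 / golden_ratio)) ^ n)"
proof -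
  let ?\<psi> = "- (1 / golden_ratio)"
  have sq: "?\<psi>\<^sup>2 = ?\<psi> + 1"
    unfolding golden_ratio_conjugate[symmetric] by (simp add: power2_eq_square field_simps)
  have step: "x ^ Suc (Suc n) = x ^ Suc n + x ^ n" if "x\<^sup>2 = x + 1" for x :: real and n
  proof -
    have "x ^ Suc (Suc n) = x\<^sup>2 * x ^ n" by (simp add: power2_eq_square)
    then show ?thesis by (simp add: that algebra_simps)
  qed
  have "real (lucas n) = golden_ratio ^ n + ?\<psi> ^ n"
  proof (induction n rule: lucas.induct)
    case 1
    show ?case by simp
  next
    case 2
    show ?case unfolding golden_ratio_conjugate[symmetric] unfolding golden_ratio_def
      by (simp add: add_divide_distrib diff_divide_distrib)
  next
    case (3 n)
    then show ?case
      by (simp only: lucas.simps of_nat_add step[OF golden_ratio_square] step[OF sq])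
  qed
  then show ?thesis by simp
qed

text \<open>
  Since \<open>m\<close> is even, \<open>U (m + b)\<close> is proportional to \<open>1 - c * y^2\<close> with the same \<open>c\<close> for which
  \<open>U b\<close> is proportional to \<open>1 - c\<close>; for odd \<open>m\<close> the sign of \<open>c\<close> would flip between the two.
  The identity \<open>1 - c * y^2 + y * (1 - c) = (1 + y) * (1 - c * y)\<close> then factors the sum.
\<close>
lemma binet_factor:
  fixes \<phi> A e :: real and b m :: nat
  assumes "\<phi> > 1" "A \<noteq> 0" "\<bar>e\<bar> \<le> 1" "even m" "m > 0"
  defines "U \<equiv> \<lambda>k. A * (\<phi> ^ k - e * (- (1 / \<phi>)) ^ k)"
    and "y \<equiv> (1 / \<phi>) ^ m" and "c \<equiv> e * (-1) ^ b * (1 / \<phi>) ^ (2 * b)"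
  shows "1 + U b / U (m + b) = (1 + y) * (1 - c * y) / (1 - c * y\<^sup>2)"
proof -
  define g where "g = 1 / \<phi>"
  have g: "0 < g" "g < 1" and inv: "\<phi> ^ k * g ^ k = 1" for k
    using assms(1) by (auto simp: g_def power_mult_distrib[symmetric])
  have U: "U k = A * (\<phi> ^ k - e * (-1) ^ k * g ^ k)" for k
    unfolding U_def g_def[symmetric] by (simp add: power_minus[of g k] mult.assoc)
  have yc: "y = g ^ m" "c = e * (-1) ^ b * (g ^ b)\<^sup>2"
    unfolding y_def c_def g_def by (simp_all add: power_mult[symmetric] mult.commute)
  have pos: "\<phi> ^ k > 0" for k
    using assms(1) by simp
  have Ub: "U b = A * \<phi> ^ b * (1 - c)"
    using inv[of b] unfolding U yc by (simp add: power2_eq_square algebra_simps)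
  have Umb: "U (m + b) = A * \<phi> ^ b * \<phi> ^ m * (1 - c * y\<^sup>2)"
  proof -
    have "\<phi> ^ b * \<phi> ^ m * (c * y\<^sup>2) = e * (-1) ^ b * (\<phi> ^ b * g ^ b) * (\<phi> ^ m * g ^ m) * g ^ b * g ^ m"
      unfolding yc by (simp add: power2_eq_square mult_ac)
    also have "\<dots> = e * (-1) ^ b * g ^ (m + b)"
      unfolding inv by (simp add: power_add mult_ac)
    finally show ?thesis
      unfolding U using \<open>even m\<close> by (simp add: power_add algebra_simps)
  qed
  have "\<bar>c * y\<^sup>2\<bar> < 1"
  proof -
    have "\<bar>c\<bar> \<le> 1"
      unfolding yc using assms(3) g
      by (auto simp: abs_mult power_abs intro!: mult_le_one power_le_one)
    moreover have "y\<^sup>2 < 1" "0 \<le> y\<^sup>2"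
      unfolding yc using g assms(5) by (auto simp: power_mult[symmetric] power_less_one_iff)
    moreover have "\<bar>c * y\<^sup>2\<bar> \<le> 1 * y\<^sup>2"
      unfolding abs_mult abs_power2 using calculation(1) by (intro mult_right_mono) auto
    ultimately show ?thesis by simp
  qed
  then have nz: "1 - c * y\<^sup>2 \<noteq> 0" by auto
  have "U b / U (m + b) = y * (1 - c) / (1 - c * y\<^sup>2)"
    unfolding Ub Umb using assms(1,2) pos[of b] pos[of m] nz inv[of m] yc(1)
    by (simp add: divide_simps) (simp add: algebra_simps)
  then have "1 + U b / U (m + b) = 1 + y * (1 - c) / (1 - c * y\<^sup>2)" by simp
  also have "\<dots> = (1 + y) * (1 - c * y) / (1 - c * y\<^sup>2)"
    using nz by (simp add: divide_simps) (simp add: algebra_simps power2_eq_square)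
  finally show ?thesis .
qed

lemma binet_product_limit:
  fixes \<phi> A e :: real
  assumes "\<phi> > 1" "A \<noteq> 0" "\<bar>e\<bar> \<le> 1" "a > 0"
    and U: "\<And>k. U k = A * (\<phi> ^ k - e * (- (1 / \<phi>)) ^ k)"
  shows "(\<lambda>N. \<Prod>n=1..N. (1 + U b / U (2 ^ n * a + b)))
           \<longlonglongrightarrow> (1 - e * (-1) ^ b * \<phi> powi (- 2 * int a - 2 * int b)) / (1 - \<phi> powi (- 2 * int a))"
proof -
  \<comment> \<open>With this \<open>y\<close>, the power \<open>y ^ 2 ^ n\<close> is \<open>1/\<phi>^m\<close> for \<open>m = 2^n * a\<close>; the product starts at \<open>y\<^sup>2\<close>.\<close>
  define y where "y = (1 / \<phi>) ^ a"
  define c where "c = e * (-1) ^ b * (1 / \<phi>) ^ (2 * b)"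
  have "1 + U b / U (2 ^ n * a + b) = (1 + y ^ 2 ^ n) * (1 - c * y ^ 2 ^ n) / (1 - c * (y ^ 2 ^ n)\<^sup>2)"
    if "n \<ge> 1" for n
    using binet_factor[OF assms(1-3), of "2 ^ n * a" b] that assms(4)
    unfolding U y_def c_def by (simp add: power_mult[symmetric] mult.commute)
  then have "(\<lambda>N. \<Prod>n=1..N. (1 + U b / U (2 ^ n * a + b)))
      = (\<lambda>N. \<Prod>n=1..N. (1 + y ^ 2 ^ n) * (1 - c * y ^ 2 ^ n) / (1 - c * (y ^ 2 ^ n)\<^sup>2))"
    by (intro ext prod.cong) auto
  moreover have "\<bar>y\<bar> < 1"
    unfolding y_def using assms(1,4) by (simp add: power_less_one_iff)
  moreover have "\<bar>c\<bar> \<le> 1"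
    unfolding c_def using assms(1,3)
    by (auto simp: abs_mult power_abs intro!: mult_le_one power_le_one)
  moreover have "y\<^sup>2 = \<phi> powi (- 2 * int a)"
    using power_int_of_nat[of \<phi> "2 * a"]
    by (simp add: y_def power_int_minus power_mult[symmetric] power_one_over inverse_eq_divide mult.commute)
  moreover have "c * y\<^sup>2 = e * (-1) ^ b * \<phi> powi (- 2 * int a - 2 * int b)"
  proof -
    have "- 2 * int a - 2 * int b = - int (2 * b + a * 2)"
      by simp
    then have "\<phi> powi (- 2 * int a - 2 * int b) = (1 / \<phi>) ^ (2 * b + a * 2)"
      by (simp only: power_int_minus power_int_of_nat power_one_over inverse_eq_divide)
    then show ?thesis
      by (simp add: c_def y_def power_add power_mult)
  qed
  ultimately show ?thesis
    using telescoping_product_limit[of y c] by simp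
qed

text \<open>
  For \<open>a = b = 1\<close> the general limits involve only these two powers; reduced to linear
  expressions in \<open>\<phi>\<close>, they make the special values a consequence of \<open>\<phi>^2 = \<phi> + 1\<close>.
\<close>
lemma golden_ratio_powi:
  "golden_ratio powi -2 = 2 - golden_ratio" "golden_ratio powi -4 = 5 - 3 * golden_ratio"
proof -
  have inv: "1 / golden_ratio = golden_ratio - 1"
    using golden_ratio_square golden_ratio_gt_1 by (simp add: field_simps power2_eq_square)
  have two: "(1 / golden_ratio)\<^sup>2 = 2 - golden_ratio"
    unfolding inv using golden_ratio_square by (simp add: power2_eq_square algebra_simps)
  have "(1 / golden_ratio) ^ 4 = ((1 / golden_ratio)\<^sup>2)\<^sup>2"
    by (simp add: power_mult[symmetric])
  also have "\<dots> = 5 - 3 * golden_ratio"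
    unfolding two using golden_ratio_square by (simp add: power2_eq_square algebra_simps)
  finally show "golden_ratio powi -4 = 5 - 3 * golden_ratio"
    by (simp add: power_int_minus power_one_over inverse_eq_divide)
  show "golden_ratio powi -2 = 2 - golden_ratio"
    using two by (simp add: power_int_minus power_one_over inverse_eq_divide)
qed

theorem proposition1:
  shows "(\<forall>a b :: nat. 0 < a \<longrightarrow> 0 < b \<longrightarrow>
            ((\<lambda>N. \<Prod>n=1..N. (1 + real (fib b) / real (fib (2 ^ n * a + b))))
               \<longlonglongrightarrow> (1 - (-1) ^ b * golden_ratio powi (- 2 * int a - 2 * int b))
                    / (1 - golden_ratio powi (- 2 * int a))) \<and>
            ((\<lambda>N. \<Prod>n=1..N. (1 + real (lucas b) / real (lucas (2 ^ n * a + b))))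
               \<longlonglongrightarrow> (1 + (-1) ^ b * golden_ratio powi (- 2 * int a - 2 * int b))
                    / (1 - golden_ratio powi (- 2 * int a))))
       \<and> ((\<lambda>N. \<Prod>n=1..N. (1 + 1 / real (fib (2 ^ n + 1)))) \<longlonglongrightarrow> 3 / golden_ratio)
       \<and> ((\<lambda>N. \<Prod>n=1..N. (1 + 1 / real (lucas (2 ^ n + 1)))) \<longlonglongrightarrow> 3 - golden_ratio)"
proof -
  have fib: "(\<lambda>N. \<Prod>n=1..N. (1 + real (fib b) / real (fib (2 ^ n * a + b))))
      \<longlonglongrightarrow> (1 - (-1) ^ b * golden_ratio powi (- 2 * int a - 2 * int b))
           / (1 - golden_ratio powi (- 2 * int a))" if "0 < a" for a b
    using binet_product_limit[OF golden_ratio_gt_1 _ _ that fib_binet, of b] by simp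
  have lucas: "(\<lambda>N. \<Prod>n=1..N. (1 + real (lucas b) / real (lucas (2 ^ n * a + b))))
      \<longlonglongrightarrow> (1 + (-1) ^ b * golden_ratio powi (- 2 * int a - 2 * int b))
           / (1 - golden_ratio powi (- 2 * int a))" if "0 < a" for a b
    using binet_product_limit[OF golden_ratio_gt_1 _ _ that lucas_binet, of b] by simp
  have ne: "golden_ratio \<noteq> 0" "golden_ratio - 1 \<noteq> 0"
    using golden_ratio_gt_1 by auto
  have "(1 + (5 - 3 * golden_ratio)) / (1 - (2 - golden_ratio)) = 3 / golden_ratio"
    using ne golden_ratio_square by (simp add: divide_simps) (simp add: algebra_simps power2_eq_square)
  then have "(\<lambda>N. \<Prod>n=1..N. (1 + 1 / real (fib (2 ^ n + 1)))) \<longlonglongrightarrow> 3 / golden_ratio"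
    using fib[of 1 1] by (simp add: golden_ratio_powi)
  moreover have "(1 - (5 - 3 * golden_ratio)) / (1 - (2 - golden_ratio)) = 3 - golden_ratio"
    using ne golden_ratio_square by (simp add: divide_simps) (simp add: algebra_simps power2_eq_square)
  then have "(\<lambda>N. \<Prod>n=1..N. (1 + 1 / real (lucas (2 ^ n + 1)))) \<longlonglongrightarrow> 3 - golden_ratio"
    using lucas[of 1 1] by (simp add: golden_ratio_powi)
  ultimately show ?thesis
    using fib lucas by blast
qed

end
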